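(* Let $n,p,r$ be positive integers. Then $$ \sum_{\ell=0}^n \ell^{p}H_{n-\ell}^{(r)}=\sum_{t=0}^{p+1} H_{n-1}^{(r-t)} \sum_{\ell=1}^{p} S(p,\ell)\,\ell!\, a_{6}(\ell,n,t), $$ where $$ a_{6}(\ell,n,t)=\frac{1}{(\ell+1)!}\sum_{i=t}^{\ell+1} s(\ell+1,i) \binom{i}{t} (-1)^{t} (n+1)^{i-t} $$ (an empty sum being $0$).
   Context: For every integer $m$ (possibly zero or negative) and $N\ge0$, $H_N^{(m)}=\sum_{j=1}^N j^{-m}$ (so $H_0^{(m)}=0$). $S(p,\ell)$ denotes Stirling numbers of the second kind ($x^p=\sum_\ell S(p,\ell)x(x-1)\cdots(x-\ell+1)$) and $s(k,i)$ the signed Stirling numbers of the first kind ($x(x-1)\cdots(x-k+1)=\sum_i s(k,i)x^i$). The convention $0^0=1$ is used. *)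

theory Defs
  imports
    Complex_Main
    "HOL-Combinatorics.Stirling"
    "HOL-Computational_Algebra.Polynomial"
begin

definition gen_harm :: "int \<Rightarrow> nat \<Rightarrow> real" where
  "gen_harm m N = (\<Sum>j=1..N. real j powi (- m))"

text \<open>
  The library's \<^const>\<open>stirling\<close> is the unsigned version; the signed numbers are
  the coefficients of the falling factorial \<open>x (x - 1) \<dots> (x - k + 1)\<close>.
\<close>

definition falling_fact_poly :: "nat \<Rightarrow> int poly" where
  "falling_fact_poly k = (\<Prod>j<k. [:- int j, 1:])"

definition signed_stirling :: "nat \<Rightarrow> nat \<Rightarrow> int" where
  "signed_stirling k i = coeff (falling_fact_poly k) i"

definition a6 :: "nat \<Rightarrow> nat \<Rightarrow> nat \<Rightarrow> real" where
  "a6 l n t = 1 / fact (l + 1) *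
     (\<Sum>i=t..l+1. of_int (signed_stirling (l + 1) i) * real (i choose t)
        * (- 1) ^ t * (real n + 1) ^ (i - t))"

lemma falling_fact_poly_Suc:
  "falling_fact_poly (Suc k) = [:- int k, 1:] * falling_fact_poly k"
  unfolding falling_fact_poly_def prod.lessThan_Suc by (rule mult.commute)

lemma signed_stirling_Suc_Suc:
  "signed_stirling (Suc k) (Suc i) = signed_stirling k i - int k * signed_stirling k (Suc i)"
  by (simp add: signed_stirling_def falling_fact_poly_Suc)

lemma signed_stirling_Suc_0: "signed_stirling (Suc k) 0 = - int k * signed_stirling k 0"
  by (simp add: signed_stirling_def falling_fact_poly_Suc)

lemma signed_stirling_eq_stirling:
  "signed_stirling k i = (- 1) ^ (k + i) * int (stirling k i)"
proof (induction k i rule: stirling.induct)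
  case (3 n)
  show ?case
    by (cases n) (simp_all add: signed_stirling_def falling_fact_poly_Suc falling_fact_poly_def
        prod.lessThan_Suc_shift del: prod.lessThan_Suc)
next
  case (4 n k)
  thus ?case
    by (simp add: signed_stirling_Suc_Suc algebra_simps)
qed (simp_all add: signed_stirling_def falling_fact_poly_def)

lemma falling_factorial_eq_sum_signed_stirling:
  fixes x :: "'a :: comm_ring_1"
  shows "(\<Prod>j<k. x - of_nat j) = (\<Sum>i\<le>k. of_int (signed_stirling k i) * x ^ i)"
proof (induction k)
  case 0
  show ?case by (simp add: signed_stirling_eq_stirling)
next
  case (Suc k)
  let ?s = "\<lambda>i. of_int (signed_stirling k i) :: 'a"
  have "(\<Sum>i\<le>Suc k. of_int (signed_stirling (Suc k) i) * x ^ i) =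
      (\<Sum>i\<le>k. x * (?s i * x ^ i)) -
      of_nat k * (?s 0 + (\<Sum>i\<le>k. ?s (Suc i) * x ^ Suc i))"
    by (subst sum.atMost_Suc_shift)
      (simp add: signed_stirling_Suc_0 signed_stirling_Suc_Suc algebra_simps
        sum_subtractf sum_distrib_left)
  also have "?s 0 + (\<Sum>i\<le>k. ?s (Suc i) * x ^ Suc i) = (\<Sum>i\<le>Suc k. ?s i * x ^ i)"
    by (subst sum.atMost_Suc_shift) simp
  also have "\<dots> = (\<Sum>i\<le>k. ?s i * x ^ i)"
    by (simp add: signed_stirling_eq_stirling)
  finally show ?case
    using Suc by (simp add: algebra_simps flip: sum_distrib_left)
qed

lemma power_eq_sum_Stirling:
  fixes x :: "'a :: comm_ring_1"
  shows "x ^ p = (\<Sum>l\<le>p. of_nat (Stirling p l) * (\<Prod>j<l. x - of_nat j))"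
proof (induction p)
  case (Suc p)
  let ?F = "\<lambda>l. \<Prod>j<l. x - of_nat j"
  have "(\<Sum>l\<le>Suc p. of_nat (Stirling (Suc p) l) * ?F l) =
      (\<Sum>l\<le>p. of_nat (Suc l) * of_nat (Stirling p (Suc l)) * ?F (Suc l))
      + (\<Sum>l\<le>p. of_nat (Stirling p l) * ?F (Suc l))"
    by (subst sum.atMost_Suc_shift)
      (simp add: distrib_right sum.distrib del: prod.lessThan_Suc)
  also have "(\<Sum>l\<le>p. of_nat (Suc l) * of_nat (Stirling p (Suc l)) * ?F (Suc l)) =
      (\<Sum>l\<le>Suc p. of_nat l * of_nat (Stirling p l) * ?F l)"
    by (subst sum.atMost_Suc_shift) simp
  also have "\<dots> = (\<Sum>l\<le>p. of_nat l * of_nat (Stirling p l) * ?F l)"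
    by simp
  also have "\<dots> + (\<Sum>l\<le>p. of_nat (Stirling p l) * ?F (Suc l)) =
      (\<Sum>l\<le>p. x * (of_nat (Stirling p l) * ?F l))"
    by (simp add: algebra_simps flip: sum.distrib)
  finally show ?case
    using Suc by (simp add: sum_distrib_left)
qed simp

end

theory Submission
  imports Defs
begin

text \<open>
  Interchanging summation turns the left-hand side into
  \<open>\<Sum>j. j\<^sup>-\<^sup>r * (\<Sum>l<n+1-j. l\<^sup>p)\<close>. In the basis of falling factorials the inner power sum is
  \<open>\<Sum>l. S(p,l) * l! * ((n+1-j) choose (l+1))\<close>, and \<open>a6 l n t\<close> is the coefficient of \<open>j\<^sup>t\<close>
  in the polynomial \<open>(n+1-j) choose (l+1)\<close>.
\<close>

lemma sum_falling_factorial: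
  "of_nat (Suc k) * (\<Sum>l<m. \<Prod>i<k. of_nat l - of_nat i) =
    (\<Prod>i<Suc k. of_nat m - (of_nat i :: 'a :: comm_ring_1))"
proof (induction m)
  case 0
  show ?case by (subst prod.lessThan_Suc_shift) simp
next
  case (Suc m)
  let ?F = "\<Prod>i<k. of_nat m - (of_nat i :: 'a)"
  \<comment> \<open>Splitting off the factor at \<open>i = 0\<close> leaves \<open>?F\<close>, while
    the product at \<open>m\<close> is \<open>(m - k) * ?F\<close>; the two differ by
    \<open>(k + 1) * ?F\<close>.\<close>
  have shift: "(\<Prod>i<Suc k. of_nat (Suc m) - (of_nat i :: 'a)) = (of_nat m + 1) * ?F"
    by (subst prod.lessThan_Suc_shift) (simp add: add.commute)
  have "of_nat (Suc k) * (\<Sum>l<Suc m. \<Prod>i<k. of_nat l - (of_nat i :: 'a)) =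
      (\<Prod>i<Suc k. of_nat m - (of_nat i :: 'a)) + of_nat (Suc k) * ?F"
    unfolding sum.lessThan_Suc distrib_left Suc.IH ..
  then show ?case
    unfolding shift by (simp add: algebra_simps)
qed

lemma sum_power_eq_sum_Stirling:
  fixes p m :: nat
  assumes "p > 0"
  shows "(\<Sum>l<m. real l ^ p) =
    (\<Sum>k=1..p. real (Stirling p k) * fact k *
      ((\<Prod>i<Suc k. real m - real i) / fact (Suc k)))"
proof -
  \<comment> \<open>This is where \<open>p > 0\<close> enters: it lets the sum start at
    \<open>k = 1\<close>.\<close>
  have S0: "Stirling p 0 = 0"
    using assms by (cases p) auto
  have "(\<Sum>l<m. real l ^ p) =
      (\<Sum>k\<le>p. real (Stirling p k) * (\<Sum>l<m. \<Prod>i<k. real l - real i))"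
    by (subst power_eq_sum_Stirling, subst sum.swap) (simp add: sum_distrib_left)
  also have "\<dots> = (\<Sum>k=1..p. real (Stirling p k) * (\<Sum>l<m. \<Prod>i<k. real l - real i))"
    using S0 by (intro sum.mono_neutral_right) (auto simp: not_le)
  also have "\<dots> = (\<Sum>k=1..p. real (Stirling p k) * fact k *
      ((\<Prod>i<Suc k. real m - real i) / fact (Suc k)))"
    by (intro sum.cong refl, subst sum_falling_factorial [symmetric])
      (simp add: field_simps del: of_nat_Suc)
  finally show ?thesis .
qed

text \<open>Signed Stirling numbers expand the falling factorial in powers of
  \<open>n + 1 - x\<close>, and the binomial theorem expands these in powers of \<open>x\<close>.
  The free bound \<open>q\<close> lets one range of \<open>t\<close> serve every \<open>l\<close>,
  as \<open>a6 l n t\<close> is an empty sum for \<open>t > l + 1\<close>.\<close>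

lemma sum_a6_power:
  assumes "l + 1 \<le> q"
  shows "(\<Sum>t\<le>q. a6 l n t * x ^ t) =
    (\<Prod>i<Suc l. real n + 1 - x - real i) / fact (Suc l)"
proof -
  let ?s = "\<lambda>i. real_of_int (signed_stirling (l + 1) i)"
  let ?b = "\<lambda>i t. real (i choose t) * (- x) ^ t * (real n + 1) ^ (i - t)"
  have "(\<Sum>t\<le>q. a6 l n t * x ^ t) =
      (\<Sum>t\<le>q. (\<Sum>i\<le>l+1. ?s i * ?b i t) / fact (l + 1))"
  proof (intro sum.cong refl)
    fix t
    \<comment> \<open>Since \<open>i choose t = 0\<close> for \<open>i < t\<close>, the range of
      \<open>i\<close> can be made independent of \<open>t\<close>, ready for the
      interchange.\<close>
    have "(\<Sum>i=t..l+1. ?s i * ?b i t) = (\<Sum>i\<le>l+1. ?s i * ?b i t)"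
      by (intro sum.mono_neutral_left) (auto simp: not_le binomial_eq_0)
    moreover have "a6 l n t * x ^ t = (\<Sum>i=t..l+1. ?s i * ?b i t) / fact (l + 1)"
      unfolding a6_def
      by (simp add: sum_distrib_right sum_distrib_left sum_divide_distrib power_minus [of x] mult_ac
          del: fact_Suc sum.cl_ivl_Suc)
    ultimately show "a6 l n t * x ^ t = (\<Sum>i\<le>l+1. ?s i * ?b i t) / fact (l + 1)"
      by simp
  qed
  also have "\<dots> = (\<Sum>i\<le>l+1. ?s i * (\<Sum>t\<le>q. ?b i t)) / fact (l + 1)"
    by (subst sum_divide_distrib [symmetric], subst sum.swap) (simp only: sum_distrib_left)
  also have "(\<Sum>i\<le>l+1. ?s i * (\<Sum>t\<le>q. ?b i t)) =
      (\<Sum>i\<le>l+1. ?s i * (real n + 1 - x) ^ i)"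
  proof (intro sum.cong refl)
    fix i assume "i \<in> {..l+1}"
    then have "(\<Sum>t\<le>q. ?b i t) = (\<Sum>t\<le>i. ?b i t)"
      using assms by (intro sum.mono_neutral_right) (auto simp: not_le binomial_eq_0)
    also have "\<dots> = (- x + (real n + 1)) ^ i"
      by (rule binomial_ring [symmetric])
    finally show "?s i * (\<Sum>t\<le>q. ?b i t) = ?s i * (real n + 1 - x) ^ i"
      by (simp add: algebra_simps)
  qed
  also have "\<dots> = (\<Prod>i<l+1. real n + 1 - x - real i)"
    by (rule falling_factorial_eq_sum_signed_stirling [symmetric])
  finally show ?thesis by simp
qed

text \<open>Both sides sum over the triangle \<open>l + j \<le> n\<close> with
  \<open>j \<ge> 1\<close>, by rows and by columns.\<close>

lemma sum_mult_gen_harm_diff: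
  "(\<Sum>l=0..n. f l * gen_harm m (n - l)) =
    (\<Sum>j=1..n. real j powi (- m) * (\<Sum>l<n + 1 - j. f l))"
proof -
  have "(\<Sum>l=0..n. f l * gen_harm m (n - l)) =
      (\<Sum>l=0..n. \<Sum>j\<in>{j\<in>{1..n}. l + j \<le> n}. f l * real j powi (- m))"
    unfolding gen_harm_def sum_distrib_left
    by (intro sum.cong refl) auto
  also have "\<dots> = (\<Sum>j=1..n. \<Sum>l\<in>{l\<in>{0..n}. l + j \<le> n}. f l * real j powi (- m))"
    by (rule sum.swap_restrict) auto
  also have "\<dots> = (\<Sum>j=1..n. real j powi (- m) * (\<Sum>l<n + 1 - j. f l))"
    unfolding sum_distrib_left by (intro sum.cong) auto
  finally show ?thesis .
qed

theorem theorem6: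
  fixes n p r :: nat
  assumes "n > 0" and "p > 0" and "r > 0"
  shows "(\<Sum>l=0..n. real l ^ p * gen_harm (int r) (n - l)) =
    (\<Sum>t=0..p+1. gen_harm (int r - int t) (n - 1) *
       (\<Sum>l=1..p. real (Stirling p l) * fact l * a6 l n t))"
proof -
  define c where "c t = (\<Sum>l=1..p. real (Stirling p l) * fact l * a6 l n t)" for t
  \<comment> \<open>The bound \<open>j \<le> n\<close> makes the truncated \<open>n + 1 - j\<close>
    agree with the real difference in \<open>sum_a6_power\<close>.\<close>
  have inner: "(\<Sum>t\<le>p+1. c t * real j ^ t) = (\<Sum>l<n + 1 - j. real l ^ p)" if "j \<le> n" for j
  proof -
    have "(\<Sum>t\<le>p+1. c t * real j ^ t) =
        (\<Sum>l=1..p. real (Stirling p l) * fact l * (\<Sum>t\<le>p+1. a6 l n t * real j ^ t))"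
      unfolding c_def sum_distrib_left sum_distrib_right
      by (subst sum.swap) (simp only: mult.assoc)
    also have "\<dots> = (\<Sum>l=1..p. real (Stirling p l) * fact l *
        ((\<Prod>i<Suc l. real (n + 1 - j) - real i) / fact (Suc l)))"
      using that by (intro sum.cong refl, subst sum_a6_power) (auto simp: of_nat_diff add.commute)
    finally show ?thesis
      by (simp only: sum_power_eq_sum_Stirling [OF \<open>p > 0\<close>])
  qed
  have "(\<Sum>l=0..n. real l ^ p * gen_harm (int r) (n - l)) =
      (\<Sum>j=1..n. real j powi (- int r) * (\<Sum>l<n + 1 - j. real l ^ p))"
    by (rule sum_mult_gen_harm_diff)
  \<comment> \<open>The term \<open>j = n\<close> vanishes because \<open>0 ^ p = 0\<close>.\<close>
  also have "\<dots> = (\<Sum>j=1..n-1. real j powi (- int r) * (\<Sum>l<n + 1 - j. real l ^ p))"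
    using \<open>n > 0\<close> \<open>p > 0\<close> by (cases n) simp_all
  also have "\<dots> = (\<Sum>j=1..n-1. \<Sum>t\<le>p+1. real j powi (- (int r - int t)) * c t)"
  proof (intro sum.cong refl)
    fix j assume j: "j \<in> {1..n-1}"
    \<comment> \<open>Splitting the exponent relies on \<open>j \<ge> 1\<close>, so that the base is
      nonzero.\<close>
    then have "real j powi (- (int r - int t)) = real j powi (- int r) * real j ^ t" for t
      by (simp add: power_int_add [symmetric] flip: power_int_of_nat)
    moreover have "j \<le> n" using j by auto
    ultimately show "real j powi (- int r) * (\<Sum>l<n + 1 - j. real l ^ p) =
        (\<Sum>t\<le>p+1. real j powi (- (int r - int t)) * c t)"
      by (simp only: inner [symmetric] sum_distrib_left mult_ac)
  qed
  also have "\<dots> = (\<Sum>t=0..p+1. gen_harm (int r - int t) (n - 1) * c t)"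
    unfolding gen_harm_def sum_distrib_right atMost_atLeast0 by (rule sum.swap)
  finally show ?thesis
    unfolding c_def .
qed

end
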